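(* Let $x\in\mathbb{R}^n$ satisfy $(L_f+L_G)\|x\|\leq\|G(0)^{-1}\|^{-1}$ and let $$\overline{\mathcal{V}}^{\mathcal{G}}_x=\mathbb{B}^n\left(f(0);\|G(0)^{-1}\|^{-1}-L_f\|x\|-L_G\|x\|\right).$$ Then $\overline{\mathcal{V}}^{\mathcal{G}}_x$ is a ball of maximal radius that is contained in $\mathcal{V}^{\mathcal{G}}_x$; that is, $\overline{\mathcal{V}}^{\mathcal{G}}_x\subseteq\mathcal{V}^{\mathcal{G}}_x$, and for every $x'\in\mathbb{R}^n$ and every $\delta>\|G(0)^{-1}\|^{-1}-L_f\|x\|-L_G\|x\|$ the ball $\mathbb{B}^n(x';\delta)$ is not contained in $\mathcal{V}^{\mathcal{G}}_x$.
   Context: Let $n\ge 1$. For vectors, $\|\cdot\|$ is the Euclidean norm; for matrices, $\|M\|=\max_{\|v\|=1}\|Mv\|$. $\mathbb{B}^n(c;r)$ is the closed ball in $\mathbb{R}^n$ with center $c$ and radius $r\ge 0$. For a vector $v$, matrix $M$ and set $\mathcal{S}$ of vectors, $v+M\mathcal{S}=\{v+Ms : s\in\mathcal{S}\}$. Setting: $\mathcal{U}=\mathbb{B}^n(0;1)$; $L_f,L_G\ge 0$ are real constants; $f:\mathbb{R}^n\to\mathbb{R}^n$ and $G:\mathbb{R}^n\to\mathbb{R}^{n\times n}$ satisfy $\|f(x)-f(y)\|\le L_f\|x-y\|$ and $\|G(x)-G(y)\|\le L_G\|x-y\|$ for all $x,y\in\mathbb{R}^n$, and $G(0)$ is invertible.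 $\mathcal{D}_{con}$ is the set of all pairs $(\hat f,\hat G)$ of functions $\hat f:\mathbb{R}^n\to\mathbb{R}^n$, $\hat G:\mathbb{R}^n\to\mathbb{R}^{n\times n}$ such that $\hat f(0)=f(0)$, $\hat G(0)=G(0)$, $\hat f$ is globally Lipschitz with constant $L_f$, and $\hat G$ is globally Lipschitz with constant $L_G$ (in the norms above). The guaranteed velocity set at $x\in\mathbb{R}^n$ is $\mathcal{V}^{\mathcal{G}}_x=\bigcap_{(\hat f,\hat G)\in\mathcal{D}_{con}}\left(\hat f(x)+\hat G(x)\,\mathcal{U}\right)$. *)

theory Defs
  imports "HOL-Analysis.Analysis"
begin

text \<open>The instance \<open>norm\<close> on \<open>real ^ 'n ^ 'm\<close> is the Frobenius norm, so the
  matrix norm induced by the Euclidean norm has to be written with \<open>onorm\<close>.\<close>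

definition op_norm :: "real ^ 'n ^ 'm \<Rightarrow> real" where
  "op_norm M = onorm (\<lambda>v. M *v v)"

text \<open>\<open>onorm\<close> is a supremum of quotients; it equals the maximum over unit vectors.\<close>

lemma op_norm_le:
  fixes M :: "real ^ 'n ^ 'm"
  shows "norm (M *v v) \<le> op_norm M * norm v"
  unfolding op_norm_def by (rule onorm) (rule matrix_vector_mul_bounded_linear)

lemma op_norm_is_max:
  fixes M :: "real ^ 'n ^ 'm"
  shows "op_norm M \<in> (\<lambda>v. norm (M *v v)) ` sphere 0 1"
    and "\<And>v. norm v = 1 \<Longrightarrow> norm (M *v v) \<le> op_norm M"
proof -
  show le: "norm (M *v v) \<le> op_norm M" if "norm v = 1" for v
    using op_norm_le[of M v] that by simp
  have ne: "sphere (0 :: real ^ 'n) 1 \<noteq> {}"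
    using norm_axis_1 by fastforce
  have cont: "continuous_on (sphere 0 1) (\<lambda>v. norm (M *v v))"
    by (intro continuous_on_norm linear_continuous_on matrix_vector_mul_bounded_linear)
  obtain w where w: "norm w = 1" and max: "\<And>v. norm v = 1 \<Longrightarrow> norm (M *v v) \<le> norm (M *v w)"
    using continuous_attains_sup[OF compact_sphere ne cont] by auto
  have "op_norm M \<le> norm (M *v w)"
    unfolding op_norm_def
  proof (rule onorm_bound)
    fix v :: "real ^ 'n"
    show "norm (M *v v) \<le> norm (M *v w) * norm v"
    proof (cases "v = 0")
      case False
      have "norm (M *v ((1 / norm v) *\<^sub>R v)) \<le> norm (M *v w)"
        using False by (intro max) simp
      then show ?thesis
        using False by (simp add: matrix_vector_mult_scaleR divide_simps)
    qed simp
  qed simp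
  then show "op_norm M \<in> (\<lambda>v. norm (M *v v)) ` sphere 0 1"
    using le[OF w] w by (intro image_eqI[of _ _ w]) auto
qed

definition op_lipschitz :: "real \<Rightarrow> (real ^ 'n \<Rightarrow> real ^ 'n ^ 'n) \<Rightarrow> bool" where
  "op_lipschitz L G \<longleftrightarrow> (\<forall>x y. op_norm (G x - G y) \<le> L * norm (x - y))"

definition D_con ::
  "real \<Rightarrow> real \<Rightarrow> (real ^ 'n \<Rightarrow> real ^ 'n) \<Rightarrow> (real ^ 'n \<Rightarrow> real ^ 'n ^ 'n) \<Rightarrow>
    ((real ^ 'n \<Rightarrow> real ^ 'n) \<times> (real ^ 'n \<Rightarrow> real ^ 'n ^ 'n)) set" where
  "D_con Lf LG f G =
    {(fh, Gh). fh 0 = f 0 \<and> Gh 0 = G 0 \<and> Lf-lipschitz_on UNIV fh \<and> op_lipschitz LG Gh}"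

definition guaranteed_velocity_set ::
  "real \<Rightarrow> real \<Rightarrow> (real ^ 'n \<Rightarrow> real ^ 'n) \<Rightarrow> (real ^ 'n \<Rightarrow> real ^ 'n ^ 'n) \<Rightarrow>
    real ^ 'n \<Rightarrow> (real ^ 'n) set" where
  "guaranteed_velocity_set Lf LG f G x =
    (\<Inter>(fh, Gh) \<in> D_con Lf LG f G. (\<lambda>u. fh x + Gh x *v u) ` cball 0 1)"

end

theory Submission
  imports Defs
begin

text \<open>
  Write \<open>s\<close> for the inverse of the norm of \<open>G(0)\<^sup>-\<^sup>1\<close>, the smallest singular value of \<open>G(0)\<close>.
  Every admissible matrix \<open>M\<close> at \<open>x\<close> satisfies \<open>norm (M u) \<ge> (s - LG * norm x) * norm u\<close>, which
  gives the inclusion. For maximality, let \<open>v\<close>, \<open>w\<close> be singular vectors for \<open>s\<close>. The choices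
  \<open>y \<mapsto> G(0) - LG * norm y * w v\<^sup>T\<close> and \<open>y \<mapsto> f(0) \<plusminus> Lf * norm y * w\<close> are admissible, and the two
  resulting ellipsoids intersect in a set of width at most \<open>2 * r\<close> in direction \<open>w\<close>.
\<close>

lemma op_norm_bound:
  assumes "0 \<le> b" and "\<And>v. norm (M *v v) \<le> b * norm v"
  shows "op_norm M \<le> b"
  unfolding op_norm_def by (rule onorm_bound) (use assms in auto)

lemma matrix_inv_mult_vector:
  fixes M :: "real ^ 'n ^ 'n"
  assumes "invertible M"
  shows "matrix_inv M *v (M *v v) = v" and "M *v (matrix_inv M *v v) = v"
proof -
  have "M ** matrix_inv M = mat 1 \<and> matrix_inv M ** M = mat 1"
    using assms unfolding invertible_def matrix_inv_def by (rule someI_ex)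
  then show "matrix_inv M *v (M *v v) = v" and "M *v (matrix_inv M *v v) = v"
    by (simp_all add: matrix_vector_mul_assoc)
qed

lemma op_norm_matrix_inv_pos:
  fixes M :: "real ^ 'n ^ 'n"
  assumes "invertible M"
  shows "op_norm (matrix_inv M) > 0"
proof -
  obtain e :: "real ^ 'n" where e: "norm e = 1"
    using norm_axis_1 by blast
  then have "matrix_inv M *v e \<noteq> 0"
    using matrix_inv_mult_vector(2)[OF assms, of e] by auto
  then have "0 < norm (matrix_inv M *v e)"
    by simp
  also have "\<dots> \<le> op_norm (matrix_inv M)"
    by (rule op_norm_is_max(2)[OF e])
  finally show ?thesis .
qed

text \<open>Apply the norm bound for the inverse matrix to \<open>M *v u\<close>.\<close>

lemma norm_matrix_mult_ge:
  fixes M :: "real ^ 'n ^ 'n"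
  assumes "invertible M"
  shows "inverse (op_norm (matrix_inv M)) * norm u \<le> norm (M *v u)"
proof -
  have "norm u \<le> op_norm (matrix_inv M) * norm (M *v u)"
    using op_norm_le[of "matrix_inv M" "M *v u"] matrix_inv_mult_vector[OF assms] by simp
  then show ?thesis
    using op_norm_matrix_inv_pos[OF assms] by (simp add: field_simps)
qed

text \<open>For small \<open>t\<close> the linear term dominates, so a nonzero \<open>b\<close>
  would make the quadratic change sign at 0.\<close>

lemma nonneg_quadratic_imp_linear_coeff_0:
  fixes b c :: real
  assumes c: "c \<ge> 0" and nonneg: "\<And>t. 0 \<le> 2 * t * b + t\<^sup>2 * c"
  shows "b = 0"
proof -
  \<comment> \<open>The minimiser would be \<open>- b / c\<close>; dividing by \<open>c + 1\<close>
    instead also covers \<open>c = 0\<close> and still gives a negative value unless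
    \<open>b = 0\<close>.\<close>
  define t where "t = - b / (c + 1)"
  have t: "t * (c + 1) = - b"
    using c by (simp add: t_def)
  have "0 \<le> (2 * t * b + t\<^sup>2 * c) * (c + 1)\<^sup>2"
    by (intro mult_nonneg_nonneg nonneg) simp
  also have "\<dots> = 2 * (t * (c + 1)) * b * (c + 1) + (t * (c + 1))\<^sup>2 * c"
    by (simp add: power2_eq_square algebra_simps)
  also have "\<dots> = - (b\<^sup>2 * (c + 2))"
    unfolding t by (simp add: power2_eq_square algebra_simps)
  finally have "b\<^sup>2 * (c + 2) \<le> 0"
    by simp
  then show ?thesis
    using c by (simp add: mult_le_0_iff)
qed

text \<open>The last property is the left singular vector equation, transpose of \<open>M\<close>
  times \<open>w\<close> equals \<open>s\<close> times \<open>v\<close>, in the form in which widths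
  in direction \<open>w\<close> are measured later. Here \<open>w\<close> is a unit vector most
  stretched by the inverse.\<close>

lemma min_singular_vectors:
  fixes M :: "real ^ 'n ^ 'n"
  assumes inv: "invertible M"
  defines "s \<equiv> inverse (op_norm (matrix_inv M))"
  obtains v w where "norm v = 1" "norm w = 1" "\<And>u. w \<bullet> (M *v u) = s * (v \<bullet> u)"
proof -
  have s: "s > 0"
    using op_norm_matrix_inv_pos[OF inv] by (simp add: s_def)
  obtain w where w: "norm w = 1" and max: "norm (matrix_inv M *v w) = op_norm (matrix_inv M)"
    using op_norm_is_max(1)[of "matrix_inv M"] by auto
  \<comment> \<open>The preimage of \<open>w\<close> has norm \<open>1 / s\<close>, so this factor
    normalises it.\<close>
  define v where "v = s *\<^sub>R (matrix_inv M *v w)"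
  have v: "norm v = 1"
    using max s by (simp add: v_def s_def)
  have Mv: "M *v v = s *\<^sub>R w"
    by (simp add: v_def matrix_vector_mult_scaleR matrix_inv_mult_vector[OF inv])
  have ge: "(s * norm u)\<^sup>2 \<le> (norm (M *v u))\<^sup>2" for u
    using norm_matrix_mult_ge[OF inv, of u] s by (intro power_mono) (auto simp: s_def)
  have "w \<bullet> (M *v u) = s * (v \<bullet> u)" for u
  proof -
    \<comment> \<open>\<open>v\<close> minimises \<open>norm (M u)\<^sup>2 - s\<^sup>2 * norm u\<^sup>2\<close>, so the first variation vanishes there.\<close>
    have "s * (w \<bullet> (M *v u)) - s\<^sup>2 * (v \<bullet> u) = 0"
    proof (rule nonneg_quadratic_imp_linear_coeff_0)
      show "0 \<le> (norm (M *v u))\<^sup>2 - (s * norm u)\<^sup>2"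
        using ge[of u] by simp
      fix t :: real
      have "(s * norm (v + t *\<^sub>R u))\<^sup>2 = s\<^sup>2 + 2 * t * s\<^sup>2 * (v \<bullet> u) + t\<^sup>2 * (s * norm u)\<^sup>2"
        using v unfolding power_mult_distrib power2_norm_eq_inner
        by (simp add: inner_add_left inner_add_right norm_eq_1 inner_commute
            power2_eq_square algebra_simps)
      moreover have "(norm (M *v (v + t *\<^sub>R u)))\<^sup>2 =
          s\<^sup>2 + 2 * t * s * (w \<bullet> (M *v u)) + t\<^sup>2 * (norm (M *v u))\<^sup>2"
        using w unfolding matrix_vector_right_distrib matrix_vector_mult_scaleR Mv power2_norm_eq_inner
        by (simp add: inner_add_left inner_add_right norm_eq_1 inner_commute
            power2_eq_square algebra_simps)
      \<comment> \<open>The constant terms of both expansions are \<open>s\<^sup>2\<close> and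
        cancel, leaving a quadratic in \<open>t\<close> that vanishes at 0.\<close>
      ultimately show "0 \<le> 2 * t * (s * (w \<bullet> (M *v u)) - s\<^sup>2 * (v \<bullet> u)) +
          t\<^sup>2 * ((norm (M *v u))\<^sup>2 - (s * norm u)\<^sup>2)"
        using ge[of "v + t *\<^sub>R u"] by (simp add: algebra_simps)
    qed
    then show ?thesis
      using s by (simp add: power2_eq_square)
  qed
  with v w show ?thesis
    by (rule that)
qed

text \<open>For \<open>m > 0\<close> the lower bound forces injectivity, hence surjectivity in
  finite dimension, and it bounds the norm of the preimage. For \<open>m = 0\<close> the matrix may
  be singular, but the ball is just the origin.\<close>

lemma matrix_ball_image_superset:
  fixes M :: "real ^ 'n ^ 'n"
  assumes ge: "\<And>u. m * norm u \<le> norm (M *v u)" and m: "m \<ge> 0"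
  shows "cball 0 m \<subseteq> (*v) M ` cball 0 1"
proof
  fix z :: "real ^ 'n" assume z: "z \<in> cball 0 m"
  show "z \<in> (*v) M ` cball 0 1"
  proof (cases "m = 0")
    case True
    then show ?thesis
      using z by (intro image_eqI[of _ _ 0]) auto
  next
    case False
    with m have "m > 0" by simp
    then have "u = 0" if "M *v u = 0" for u
      using ge[of u] that by (simp add: mult_le_0_iff)
    then have "inj ((*v) M)"
      by (simp add: linear_injective_0)
    then have "surj ((*v) M)"
      by (simp add: linear_injective_imp_surjective)
    then obtain u where u: "z = M *v u"
      by blast
    have "m * norm u \<le> m * 1"
      using ge[of u] z u by simp
    then have "norm u \<le> 1"
      using \<open>m > 0\<close> by (simp del: mult_1_right)
    then show ?thesis
      using u by auto
  qed
qed

text \<open>The radius \<open>s\<close> of a ball inside the image of the unit ball under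
  \<open>G 0\<close> loses at most \<open>LG * norm x\<close> when the matrix changes to
  \<open>Gh x\<close>, and at most \<open>Lf * norm x\<close> when the centre moves to
  \<open>fh x\<close>.\<close>

lemma D_con_velocity_superset:
  fixes G :: "real ^ 'n \<Rightarrow> real ^ 'n ^ 'n"
  assumes inv: "invertible (G 0)"
    and le: "(Lf + LG) * norm x \<le> inverse (op_norm (matrix_inv (G 0)))"
    and Lf: "Lf \<ge> 0"
    and D: "(fh, Gh) \<in> D_con Lf LG f G"
  shows "cball (f 0) (inverse (op_norm (matrix_inv (G 0))) - Lf * norm x - LG * norm x) \<subseteq>
    (\<lambda>u. fh x + Gh x *v u) ` cball 0 1"
proof
  define s where "s = inverse (op_norm (matrix_inv (G 0)))"
  fix y assume "y \<in> cball (f 0) (inverse (op_norm (matrix_inv (G 0))) - Lf * norm x - LG * norm x)"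
  then have y: "norm (y - f 0) \<le> s - Lf * norm x - LG * norm x"
    by (simp add: s_def dist_norm norm_minus_commute)
  have fh: "norm (fh x - f 0) \<le> Lf * norm x"
    using D lipschitz_onD[of Lf UNIV fh x 0] by (simp add: D_con_def dist_norm)
  have Gh: "op_norm (Gh x - G 0) \<le> LG * norm x"
  proof -
    have "op_lipschitz LG Gh" and "Gh 0 = G 0"
      using D by (simp_all add: D_con_def)
    then have "op_norm (Gh x - Gh 0) \<le> LG * norm (x - 0)"
      unfolding op_lipschitz_def by blast
    with \<open>Gh 0 = G 0\<close> show ?thesis
      by simp
  qed
  have ge: "(s - LG * norm x) * norm u \<le> norm (Gh x *v u)" for u
  proof -
    have "norm ((Gh x - G 0) *v u) \<le> LG * norm x * norm u"
      by (rule order.trans[OF op_norm_le mult_right_mono[OF Gh]]) simp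
    moreover have "s * norm u \<le> norm (G 0 *v u)"
      unfolding s_def by (rule norm_matrix_mult_ge[OF inv])
    moreover have "norm (G 0 *v u) \<le> norm (Gh x *v u) + norm ((Gh x - G 0) *v u)"
      by (simp add: matrix_vector_mult_diff_rdistrib norm_triangle_sub norm_minus_commute)
    ultimately show ?thesis
      by (simp add: algebra_simps)
  qed
  have "norm (y - fh x) \<le> norm (y - f 0) + norm (fh x - f 0)"
    by (metis dist_norm dist_triangle2)
  with y fh have "y - fh x \<in> cball 0 (s - LG * norm x)"
    by simp
  moreover have "0 \<le> s - LG * norm x"
    using le mult_nonneg_nonneg[OF Lf norm_ge_zero[of x]] by (simp add: s_def distrib_right)
  ultimately obtain u where "y - fh x = Gh x *v u" "u \<in> cball 0 1"
    using matrix_ball_image_superset[OF ge] by blast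
  then show "y \<in> (\<lambda>u. fh x + Gh x *v u) ` cball 0 1"
    by (intro image_eqI[of _ _ u]) (auto simp: algebra_simps)
qed

lemma rank_one_mult_vector:
  fixes v w :: "real ^ 'n"
  shows "(\<chi> i j. w $ i * v $ j) *v u = (v \<bullet> u) *\<^sub>R w"
  by (simp add: vec_eq_iff matrix_vector_mult_def inner_vec_def sum_distrib_left
      sum_distrib_right mult_ac)

text \<open>The norm is 1-Lipschitz and the rank-one matrix has operator norm at most 1, so the
  slopes are as prescribed. Keeping \<open>w'\<close> apart from \<open>w\<close> allows both signs
  of the shift of the centre.\<close>

lemma cone_perturbation_in_D_con:
  fixes v w w' :: "real ^ 'n"
  assumes Lf: "Lf \<ge> 0" and LG: "LG \<ge> 0"
    and v: "norm v = 1" and w: "norm w = 1" and w': "norm w' = 1"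
  shows "(\<lambda>y. f 0 + (Lf * norm y) *\<^sub>R w', \<lambda>y. G 0 - (LG * norm y) *\<^sub>R (\<chi> i j. w $ i * v $ j))
    \<in> D_con Lf LG f G"
proof -
  have diff: "\<bar>norm y - norm z\<bar> \<le> norm (y - z)" for y z :: "real ^ 'n"
    by (rule norm_triangle_ineq3)
  have "Lf-lipschitz_on UNIV (\<lambda>y :: real ^ 'n. f 0 + (Lf * norm y) *\<^sub>R w')"
    by (rule lipschitz_onI)
      (use Lf w' in \<open>auto simp: dist_norm abs_mult intro!: mult_left_mono diff
        simp flip: scaleR_diff_left right_diff_distrib\<close>)
  moreover have "op_norm ((G 0 - (LG * norm y) *\<^sub>R (\<chi> i j. w $ i * v $ j))
      - (G 0 - (LG * norm z) *\<^sub>R (\<chi> i j. w $ i * v $ j))) \<le> LG * norm (y - z)" for y z :: "real ^ 'n"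
  proof (rule op_norm_bound)
    fix u :: "real ^ 'n"
    let ?E = "(\<chi> i j. w $ i * v $ j) :: real ^ 'n ^ 'n"
    have "(G 0 - (LG * norm y) *\<^sub>R ?E) - (G 0 - (LG * norm z) *\<^sub>R ?E)
        = (LG * (norm z - norm y)) *\<^sub>R ?E"
      by (simp add: algebra_simps)
    then have "norm (((G 0 - (LG * norm y) *\<^sub>R ?E) - (G 0 - (LG * norm z) *\<^sub>R ?E)) *v u)
        = LG * \<bar>norm y - norm z\<bar> * \<bar>v \<bullet> u\<bar>"
      using LG w by (simp add: rank_one_mult_vector abs_mult abs_minus_commute
          flip: scaleR_matrix_vector_assoc)
    also have "\<dots> \<le> LG * norm (y - z) * norm u"
      using LG diff[of y z] Cauchy_Schwarz_ineq2[of v u] v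
      by (intro mult_mono) auto
    finally show "norm (((G 0 - (LG * norm y) *\<^sub>R ?E) - (G 0 - (LG * norm z) *\<^sub>R ?E)) *v u)
        \<le> LG * norm (y - z) * norm u" .
  qed (use LG in simp)
  ultimately show ?thesis
    by (simp add: D_con_def op_lipschitz_def)
qed

lemma guaranteed_velocity_width:
  fixes G :: "real ^ 'n \<Rightarrow> real ^ 'n ^ 'n"
  assumes Lf: "Lf \<ge> 0" and LG: "LG \<ge> 0" and inv: "invertible (G 0)"
    and le: "LG * norm x \<le> inverse (op_norm (matrix_inv (G 0)))"
  obtains w where "norm w = 1"
    "\<forall>z \<in> guaranteed_velocity_set Lf LG f G x.
      \<bar>w \<bullet> (z - f 0)\<bar> \<le> inverse (op_norm (matrix_inv (G 0))) - Lf * norm x - LG * norm x"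
proof -
  define s where "s = inverse (op_norm (matrix_inv (G 0)))"
  obtain v w where v: "norm v = 1" and w: "norm w = 1"
    and G0: "\<And>u. w \<bullet> (G 0 *v u) = s * (v \<bullet> u)"
    using min_singular_vectors[OF inv] unfolding s_def by blast
  define E :: "real ^ 'n ^ 'n" where "E = (\<chi> i j. w $ i * v $ j)"
  have ww: "w \<bullet> w = 1"
    using w by (simp add: norm_eq_1)
  \<comment> \<open>The sign \<open>c\<close> selects one of the two ellipsoids. Subtracting the
    rank-one term lowers the singular value belonging to \<open>v\<close> and \<open>w\<close> from
    \<open>s\<close> to \<open>s - LG * norm x\<close>, the half-width in direction
    \<open>w\<close>.\<close>
  have *: "\<bar>w \<bullet> (z - f 0) - c * (Lf * norm x)\<bar> \<le> s - LG * norm x"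
    if z: "z \<in> guaranteed_velocity_set Lf LG f G x" and c: "\<bar>c\<bar> = 1" for z c
  proof -
    have "norm (c *\<^sub>R w) = 1"
      using c w by simp
    from cone_perturbation_in_D_con[OF Lf LG v w this, of f G]
    have "z \<in> (\<lambda>u. f 0 + (Lf * norm x) *\<^sub>R (c *\<^sub>R w) + (G 0 - (LG * norm x) *\<^sub>R E) *v u) ` cball 0 1"
      using z unfolding guaranteed_velocity_set_def E_def by fastforce
    then obtain u where u: "norm u \<le> 1"
      and "z = f 0 + (Lf * norm x) *\<^sub>R (c *\<^sub>R w) + (G 0 - (LG * norm x) *\<^sub>R E) *v u"
      by auto
    then have eq: "z - f 0 = (Lf * norm x * c) *\<^sub>R w + (G 0 *v u - (LG * norm x * (v \<bullet> u)) *\<^sub>R w)"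
      by (simp add: E_def rank_one_mult_vector matrix_vector_mult_diff_rdistrib
          flip: scaleR_matrix_vector_assoc)
    have "w \<bullet> (z - f 0) - c * (Lf * norm x) = (s - LG * norm x) * (v \<bullet> u)"
      unfolding eq by (simp add: inner_add_right inner_diff_right ww G0 algebra_simps)
    moreover have "\<bar>(s - LG * norm x) * (v \<bullet> u)\<bar> \<le> (s - LG * norm x) * 1"
      unfolding abs_mult using Cauchy_Schwarz_ineq2[of v u] u v le
      by (intro mult_mono) (auto simp: s_def)
    ultimately show ?thesis
      by simp
  qed
  \<comment> \<open>The shift by \<open>+w\<close> gives the lower bound, the shift by
    \<open>-w\<close> the upper one.\<close>
  have "\<bar>w \<bullet> (z - f 0)\<bar> \<le> s - Lf * norm x - LG * norm x"
    if "z \<in> guaranteed_velocity_set Lf LG f G x" for z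
    using *[OF that, of 1] *[OF that, of "-1"] by (simp add: abs_le_iff)
  with w show ?thesis
    unfolding s_def by (intro that) auto
qed

theorem proposition2:
  fixes f :: "real ^ 'n \<Rightarrow> real ^ 'n"
    and G :: "real ^ 'n \<Rightarrow> real ^ 'n ^ 'n"
    and Lf LG r :: real
    and x :: "real ^ 'n"
  assumes "Lf \<ge> 0" and "LG \<ge> 0"
    and "Lf-lipschitz_on UNIV f"
    and "op_lipschitz LG G"
    and "invertible (G 0)"
    and "(Lf + LG) * norm x \<le> inverse (op_norm (matrix_inv (G 0)))"
  defines "r \<equiv> inverse (op_norm (matrix_inv (G 0))) - Lf * norm x - LG * norm x"
  shows "cball (f 0) r \<subseteq> guaranteed_velocity_set Lf LG f G x \<and>
    (\<forall>x' \<delta>. \<delta> > r \<longrightarrow> \<not> cball x' \<delta> \<subseteq> guaranteed_velocity_set Lf LG f G x)"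
proof (intro conjI allI impI notI)
  show "cball (f 0) r \<subseteq> guaranteed_velocity_set Lf LG f G x"
    using D_con_velocity_superset[where f = f and G = G, OF assms(5,6,1), folded r_def]
    unfolding guaranteed_velocity_set_def by (intro INT_greatest) (auto split: prod.splits simp del: mem_cball)
next
  fix x' \<delta>
  assume \<delta>: "r < \<delta>" and sub: "cball x' \<delta> \<subseteq> guaranteed_velocity_set Lf LG f G x"
  have r: "r \<ge> 0"
    using assms(6) by (simp add: r_def algebra_simps)
  have "LG * norm x \<le> inverse (op_norm (matrix_inv (G 0)))"
    using r mult_nonneg_nonneg[OF assms(1) norm_ge_zero[of x]] by (simp add: r_def)
  then obtain w where w: "norm w = 1"
    and width: "\<forall>z \<in> guaranteed_velocity_set Lf LG f G x. \<bar>w \<bullet> (z - f 0)\<bar> \<le> r"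
    by (rule guaranteed_velocity_width[where f = f and G = G and x = x,
          OF assms(1,2,5), folded r_def]) (rule that)
  \<comment> \<open>These antipodal points differ by \<open>2 * \<delta>\<close> in direction
    \<open>w\<close>, more than the available width \<open>2 * r\<close>, wherever the centre
    \<open>x'\<close> lies.\<close>
  have "x' + \<delta> *\<^sub>R w \<in> cball x' \<delta>" "x' - \<delta> *\<^sub>R w \<in> cball x' \<delta>"
    using w r \<delta> by (auto simp: dist_norm)
  with sub have "\<bar>w \<bullet> (x' + \<delta> *\<^sub>R w - f 0)\<bar> \<le> r" "\<bar>w \<bullet> (x' - \<delta> *\<^sub>R w - f 0)\<bar> \<le> r"
    by (auto intro!: width[rule_format])
  moreover have "w \<bullet> w = 1"
    using w by (simp add: norm_eq_1)
  ultimately show False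
    using \<delta> by (simp add: inner_add_right inner_diff_right abs_le_iff)
qed

end
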